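(* Let $\Omega\subset\mathbb{R}^N$ be open, let $f\in C(\Omega)$ satisfy $f\le 0$ in $\Omega$, and set $\Gamma=\{x\in\Omega : f(x)=0\}$. Let $F:\mathbb{S}^N\to\mathbb{R}$ satisfy (F1), (F2) and (F4), and assume that $\Gamma\ne\Omega$. Let $u\in\mathrm{LSC}(\Omega)$ be a viscosity supersolution of $$F(D^2u)=f\quad\text{in }\Omega.$$ Assume that $u\ge 0$ in $\Omega$ and that for any nonempty closed subset $\Gamma_0$ of $\Gamma$, condition (G$_{F,\Omega,U}$) with $U:=\Omega\setminus\Gamma_0$ does not hold. Then $u>0$ in $\Omega$.
   Context: $\mathbb{S}^N$ is the space of real symmetric $N\times N$ matrices with its usual order. Hypotheses on $F$: (F1) $F$ is continuous. (F2) $F(X)\le F(Y)$ whenever $X\le Y$. (F4) There is a function $h:(0,\infty)\to(0,\infty)$ with $F(tX)=h(t)F(X)$ for all $t>0$, $X\in\mathbb{S}^N$. Closed subsets of $\Gamma$ are understood in the relative topology (equivalently, relatively closed in $\Omega$, since $\Gamma$ is relatively closed in $\Omega$). Condition (G$_{F,\Omega,U}$) for an open set $U\subset\Omega$: if $\phi\in C^2(\Omega)$, $\hat x\in\Omega\setminus U$ and $\phi\le\phi(\hat x)=0$ in $\Omega\setminus U$, then $F(D^2\phi(\hat x))\le 0$. $\mathrm{LSC}(\Omega)$ is the set of lower semicontinuous functions $\Omega\to\mathbb{R}$. A function $u\in\mathrm{LSC}(\Omega)$ is a (viscosity) supersolution of $F(D^2u)=f$ in $\Omega$ if, whenever $\phi\in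 C^2(\Omega)$ and $u-\phi$ has a local minimum at $\hat x\in\Omega$, one has $F(D^2\phi(\hat x))\le f(\hat x)$.
   Formalization: The hypothesis F(0) ≥ 0 is added; it excludes exactly the negative constant F. Without it the claim is false: F ≡ −1, h ≡ 1, f ≡ −1, u ≡ 0 on nonempty Ω satisfies every hypothesis (Γ is empty), but u is not positive. *)

theory Defs
  imports "HOL-Analysis.Analysis"
begin

definition sym_matrices :: "(real^'n^'n) set" where
  "sym_matrices = {X. transpose X = X}"

definition psd_le :: "real^'n^'n \<Rightarrow> real^'n^'n \<Rightarrow> bool" where
  "psd_le X Y \<longleftrightarrow> (\<forall>\<xi>. \<xi> \<bullet> (X *v \<xi>) \<le> \<xi> \<bullet> (Y *v \<xi>))"

(* Operators F are total functions on square matrices; only their values on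
   symmetric matrices are ever constrained or used. *)

definition condF1 :: "(real^'n^'n \<Rightarrow> real) \<Rightarrow> bool" where
  "condF1 F \<longleftrightarrow> continuous_on sym_matrices F"

definition condF2 :: "(real^'n^'n \<Rightarrow> real) \<Rightarrow> bool" where
  "condF2 F \<longleftrightarrow> (\<forall>X\<in>sym_matrices. \<forall>Y\<in>sym_matrices. psd_le X Y \<longrightarrow> F X \<le> F Y)"

(* Taking X = 0 in this condition gives F 0 = 0 or h = 1 identically; in the second case a
   continuous F is constant.  Thus condF1 and condF4 do admit nonzero constant operators;
   requiring F 0 >= 0 in addition excludes exactly the negative constants. *)
definition condF4 :: "(real^'n^'n \<Rightarrow> real) \<Rightarrow> bool" where
  "condF4 F \<longleftrightarrow> (\<exists>h::real \<Rightarrow> real. (\<forall>t>0. h t > 0) \<and>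
     (\<forall>t>0. \<forall>X\<in>sym_matrices. F (t *\<^sub>R X) = h t * F X))"

definition gradient :: "(real^'n \<Rightarrow> real) \<Rightarrow> real^'n \<Rightarrow> real^'n" where
  "gradient \<phi> x = (\<chi> i. frechet_derivative \<phi> (at x) (axis i 1))"

definition hessian :: "(real^'n \<Rightarrow> real) \<Rightarrow> real^'n \<Rightarrow> real^'n^'n" where
  "hessian \<phi> x = jacobian (gradient \<phi>) (at x)"

(* Intended for open S, where the derivatives at points of S depend on the values of
   the function on S only. *)
definition C2_on :: "(real^'n) set \<Rightarrow> (real^'n \<Rightarrow> real) \<Rightarrow> bool" where
  "C2_on S \<phi> \<longleftrightarrow>
     (\<forall>x\<in>S. \<phi> differentiable (at x)) \<and>
     (\<forall>x\<in>S. gradient \<phi> differentiable (at x)) \<and>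
     continuous_on S (hessian \<phi>)"

definition LSC_on :: "'a::topological_space set \<Rightarrow> ('a \<Rightarrow> real) \<Rightarrow> bool" where
  "LSC_on S u \<longleftrightarrow> (\<forall>x\<in>S. \<forall>a<u x. \<forall>\<^sub>F y in at x within S. a < u y)"

definition supersolution ::
    "(real^'n^'n \<Rightarrow> real) \<Rightarrow> (real^'n \<Rightarrow> real) \<Rightarrow> (real^'n) set \<Rightarrow> (real^'n \<Rightarrow> real) \<Rightarrow> bool" where
  "supersolution F f \<Omega> u \<longleftrightarrow> LSC_on \<Omega> u \<and>
     (\<forall>\<phi> z. C2_on \<Omega> \<phi> \<and> z \<in> \<Omega> \<and>
        (\<forall>\<^sub>F y in at z within \<Omega>. u z - \<phi> z \<le> u y - \<phi> y)
        \<longrightarrow> F (hessian \<phi> z) \<le> f z)"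

definition condG :: "(real^'n^'n \<Rightarrow> real) \<Rightarrow> (real^'n) set \<Rightarrow> (real^'n) set \<Rightarrow> bool" where
  "condG F \<Omega> U \<longleftrightarrow>
     (\<forall>\<phi> z. C2_on \<Omega> \<phi> \<and> z \<in> \<Omega> - U \<and> \<phi> z = 0 \<and> (\<forall>x\<in>\<Omega> - U. \<phi> x \<le> \<phi> z)
        \<longrightarrow> F (hessian \<phi> z) \<le> 0)"

end

theory Submission
  imports Defs
begin

text \<open>
  The zero set \<open>\<Gamma>\<^sub>0\<close> of \<open>u\<close> is relatively closed, and it is contained in \<open>\<Gamma>\<close> because \<open>0\<close> is a test
  function at each of its points.  If it were nonempty, failure of the condition would give \<open>\<phi>\<close>
  with \<open>\<phi> \<le> \<phi> z = 0\<close> on \<open>\<Gamma>\<^sub>0\<close> and \<open>F (D\<^sup>2 \<phi> z) > 0\<close>; replacing \<open>\<phi>\<close> by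
  \<open>\<phi> - \<epsilon> \<bar>x - z\<bar>\<^sup>2\<close> makes the maximum strict.  For small \<open>t > 0\<close> the function \<open>u - t \<phi>\<close> is then
  positive on a small sphere about \<open>z\<close> but vanishes at \<open>z\<close>, so it has an interior local minimum
  near \<open>z\<close>.  There the equation and homogeneity give \<open>F (D\<^sup>2 \<phi>) \<le> 0\<close>, contradicting continuity.
  Homogeneity and continuity concern symmetric matrices only, so symmetry of second derivatives
  is needed.
\<close>

section \<open>Symmetry of second derivatives\<close>

text \<open>The mean value theorem along \<open>a\<close>, applied to the increment in direction
  \<open>b\<close>, reduces the second difference to values of \<open>D y a\<close>. Expanding these
  to first order at \<open>x\<close>, the unknown intermediate parameter cancels by linearity of
  \<open>L\<close>.\<close>

lemma second_difference_tendsto: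
  fixes \<phi> :: "'a::real_normed_vector \<Rightarrow> real"
  assumes S: "open S" "x \<in> S"
    and D: "\<And>y. y \<in> S \<Longrightarrow> (\<phi> has_derivative D y) (at y)"
    and L: "((\<lambda>y. D y a) has_derivative L) (at x)"
  shows "((\<lambda>h. (\<phi> (x + h *\<^sub>R a + h *\<^sub>R b) - \<phi> (x + h *\<^sub>R a) - \<phi> (x + h *\<^sub>R b) + \<phi> x) / h\<^sup>2)
            \<longlongrightarrow> L b) (at_right 0)"
proof (rule tendstoI)
  fix e :: real assume "e > 0"
  \<comment> \<open>\<open>h * c\<close> bounds every displacement along \<open>a\<close> and
    \<open>b\<close> with coefficients in \<open>[0, h]\<close>, and also the sum of the two lengths
    in the remainder estimate; the summand 1 makes the latter bound strict and \<open>c\<close>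
    positive.\<close>
  define c where "c = 2 * norm a + norm b + 1"
  have c: "c > 0" by (simp add: c_def add_nonneg_pos)
  define e' where "e' = e / c"
  have e': "e' > 0" using \<open>e > 0\<close> c by (simp add: e'_def)
  obtain d where d: "d > 0"
    and dL: "\<And>y. norm (y - x) < d \<Longrightarrow> norm (D y a - D x a - L (y - x)) \<le> e' * norm (y - x)"
    using L e' unfolding has_derivative_at_alt by blast
  have linL: "linear L" using L by (rule has_derivative_linear)
  obtain r where r: "r > 0" "ball x r \<subseteq> S"
    using S openE by blast
  define k where "k = min d r / c"
  have k: "k > 0" using d r c by (simp add: k_def)
  have "dist ((\<phi> (x + h *\<^sub>R a + h *\<^sub>R b) - \<phi> (x + h *\<^sub>R a) - \<phi> (x + h *\<^sub>R b) + \<phi> x) / h\<^sup>2) (L b) < e"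
    if h: "0 < h" "h < k" for h
  proof -
    have hc: "h * c < min d r" using h(2) c by (simp add: k_def pos_less_divide_eq)
    have bnd: "norm (s *\<^sub>R a + t *\<^sub>R b) < min d r"
      if "0 \<le> s" "s \<le> h" "0 \<le> t" "t \<le> h" for s t
    proof -
      have "norm (s *\<^sub>R a + t *\<^sub>R b) \<le> s * norm a + t * norm b"
        using norm_triangle_ineq[of "s *\<^sub>R a" "t *\<^sub>R b"] that by simp
      also have "\<dots> \<le> h * norm a + h * norm b"
        using that by (intro add_mono mult_right_mono) auto
      also have "\<dots> \<le> h * c" using h by (simp add: c_def algebra_simps)
      finally show ?thesis using hc by linarith
    qed
    have inS: "x + s *\<^sub>R a + t *\<^sub>R b \<in> S"
      if "0 \<le> s" "s \<le> h" "0 \<le> t" "t \<le> h" for s t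
    proof -
      have "x + (s *\<^sub>R a + t *\<^sub>R b) \<in> ball x r"
        using bnd[OF that] dist_add_cancel[of x 0] by (simp only: mem_ball add_0_right dist_0_norm)
      then show ?thesis using r(2) by (auto simp: add.assoc)
    qed
    have der: "((\<lambda>s. \<phi> (x + s *\<^sub>R a + t *\<^sub>R b)) has_derivative (\<lambda>v. v * D (x + s *\<^sub>R a + t *\<^sub>R b) a))
                 (at s within {0..h})"
      if st: "0 \<le> s" "s \<le> h" "0 \<le> t" "t \<le> h" for s t
    proof -
      have "((\<lambda>s. x + s *\<^sub>R a + t *\<^sub>R b) has_derivative (\<lambda>v. v *\<^sub>R a)) (at s within {0..h})"
        by (auto intro!: derivative_eq_intros)
      from has_derivative_compose[OF this D[OF inS[OF st]]]
      show ?thesis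
        using has_derivative_linear[OF D[OF inS[OF st]]] by (simp add: linear_cmul)
    qed
    \<comment> \<open>\<open>p h - p 0\<close> is the second difference. The term
      \<open>0 *\<^sub>R b\<close> is kept so that \<open>der\<close> covers both summands.\<close>
    define p where "p s = \<phi> (x + s *\<^sub>R a + h *\<^sub>R b) - \<phi> (x + s *\<^sub>R a + 0 *\<^sub>R b)" for s
    have "\<exists>s\<in>{0<..<h}. p h - p 0 =
        (h - 0) * D (x + s *\<^sub>R a + h *\<^sub>R b) a - (h - 0) * D (x + s *\<^sub>R a + 0 *\<^sub>R b) a"
      unfolding p_def using h
      by (intro mvt_simple[where f' = "\<lambda>s v. v * D (x + s *\<^sub>R a + h *\<^sub>R b) a - v * D (x + s *\<^sub>R a + 0 *\<^sub>R b) a"]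
          has_derivative_diff der) auto
    then obtain s where s: "0 < s" "s < h"
      and ps: "p h - p 0 = h * D (x + s *\<^sub>R a + h *\<^sub>R b) a - h * D (x + s *\<^sub>R a) a"
      by auto
    \<comment> \<open>\<open>A\<close> and \<open>B\<close> are the remainders at the two ends of
      the \<open>b\<close>-increment; in \<open>A - B\<close> the contributions of
      \<open>D x a\<close> and of \<open>s\<close> through \<open>L\<close> cancel.\<close>
    define A where "A = D (x + s *\<^sub>R a + h *\<^sub>R b) a - D x a - L (s *\<^sub>R a + h *\<^sub>R b)"
    define B where "B = D (x + s *\<^sub>R a) a - D x a - L (s *\<^sub>R a)"
    have nA: "\<bar>A\<bar> \<le> e' * norm (s *\<^sub>R a + h *\<^sub>R b)"
      using dL[of "x + s *\<^sub>R a + h *\<^sub>R b"] bnd[of s h] s h by (simp add: A_def add.assoc)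
    have nB: "\<bar>B\<bar> \<le> e' * norm (s *\<^sub>R a)"
      using dL[of "x + s *\<^sub>R a"] bnd[of s 0] s h by (simp add: B_def)
    have "norm (s *\<^sub>R a + h *\<^sub>R b) + norm (s *\<^sub>R a) \<le> 2 * (s * norm a) + h * norm b"
      using norm_triangle_ineq[of "s *\<^sub>R a" "h *\<^sub>R b"] s h by simp
    also have "\<dots> \<le> 2 * (h * norm a) + h * norm b"
      using s by (intro add_mono mult_left_mono mult_right_mono) auto
    also have "\<dots> < h * c" using h by (simp add: c_def algebra_simps)
    finally have "e' * (norm (s *\<^sub>R a + h *\<^sub>R b) + norm (s *\<^sub>R a)) < e' * (h * c)"
      using e' by simp
    also have "e' * (h * c) = h * e" using c by (simp add: e'_def)
    finally have AB: "\<bar>A - B\<bar> < h * e" using nA nB by (simp add: distrib_left)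
    have "p h - p 0 = h * (A - B + h * L b)"
      unfolding ps A_def B_def linear_add[OF linL] linear_cmul[OF linL] by (simp add: algebra_simps)
    then have "\<phi> (x + h *\<^sub>R a + h *\<^sub>R b) - \<phi> (x + h *\<^sub>R a) - \<phi> (x + h *\<^sub>R b) + \<phi> x
        = h * (A - B + h * L b)"
      by (simp add: p_def)
    moreover have "h * (A - B + h * L b) / h\<^sup>2 - L b = (A - B) / h"
      using h by (simp add: field_simps power2_eq_square)
    ultimately have "(\<phi> (x + h *\<^sub>R a + h *\<^sub>R b) - \<phi> (x + h *\<^sub>R a) - \<phi> (x + h *\<^sub>R b) + \<phi> x) / h\<^sup>2 - L b
        = (A - B) / h"
      by (simp only:)
    then show ?thesis
      using AB h by (simp add: dist_real_def pos_divide_less_eq mult.commute)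
  qed
  then show "\<forall>\<^sub>F h in at_right 0.
      dist ((\<phi> (x + h *\<^sub>R a + h *\<^sub>R b) - \<phi> (x + h *\<^sub>R a) - \<phi> (x + h *\<^sub>R b) + \<phi> x) / h\<^sup>2) (L b) < e"
    using k unfolding eventually_at_right_field by blast
qed

text \<open>The second difference is invariant under swapping \<open>a\<close> and \<open>b\<close>,
  while the preceding lemma gives it both values as limits.\<close>

lemma symmetric_second_derivative:
  fixes \<phi> :: "'a::real_normed_vector \<Rightarrow> real"
  assumes "open S" "x \<in> S"
    and "\<And>y. y \<in> S \<Longrightarrow> (\<phi> has_derivative D y) (at y)"
    and "\<And>v. ((\<lambda>y. D y v) has_derivative H v) (at x)"
  shows "H a b = H b a"
proof (rule tendsto_unique)
  show "((\<lambda>h. (\<phi> (x + h *\<^sub>R a + h *\<^sub>R b) - \<phi> (x + h *\<^sub>R a) - \<phi> (x + h *\<^sub>R b) + \<phi> x) / h\<^sup>2)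
            \<longlongrightarrow> H a b) (at_right 0)"
    using assms by (rule second_difference_tendsto)
  have "((\<lambda>h. (\<phi> (x + h *\<^sub>R b + h *\<^sub>R a) - \<phi> (x + h *\<^sub>R b) - \<phi> (x + h *\<^sub>R a) + \<phi> x) / h\<^sup>2)
            \<longlongrightarrow> H b a) (at_right 0)"
    using assms by (rule second_difference_tendsto)
  then show "((\<lambda>h. (\<phi> (x + h *\<^sub>R a + h *\<^sub>R b) - \<phi> (x + h *\<^sub>R a) - \<phi> (x + h *\<^sub>R b) + \<phi> x) / h\<^sup>2)
            \<longlongrightarrow> H b a) (at_right 0)"
    by (simp add: algebra_simps)
qed simp

section \<open>Calculus of gradients and Hessians\<close>

lemma gradient_works:
  fixes \<phi> :: "real^'n \<Rightarrow> real"
  assumes "\<phi> differentiable (at x)"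
  shows "(\<phi> has_derivative (\<lambda>v. gradient \<phi> x \<bullet> v)) (at x)"
proof -
  let ?D = "frechet_derivative \<phi> (at x)"
  have D: "(\<phi> has_derivative ?D) (at x)"
    using assms frechet_derivative_works by blast
  have lin: "linear ?D" using D by (rule has_derivative_linear)
  have "?D v = gradient \<phi> x \<bullet> v" for v
  proof -
    have "?D v = ?D (\<Sum>i\<in>UNIV. v $ i *\<^sub>R axis i 1)"
      using basis_expansion[of v] by (simp add: scalar_mult_eq_scaleR)
    also have "\<dots> = (\<Sum>i\<in>UNIV. v $ i * ?D (axis i 1))"
      by (simp add: linear_sum[OF lin] linear_cmul[OF lin])
    finally show ?thesis by (simp add: gradient_def inner_vec_def mult.commute)
  qed
  then have "?D = (\<lambda>v. gradient \<phi> x \<bullet> v)" by blast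
  then show ?thesis using D by simp
qed

lemma gradient_unique:
  fixes \<phi> :: "real^'n \<Rightarrow> real"
  assumes "(\<phi> has_derivative (\<lambda>v. g \<bullet> v)) (at x)"
  shows "gradient \<phi> x = g"
  by (simp add: vec_eq_iff gradient_def frechet_derivative_at[OF assms, symmetric] inner_axis)

lemma hessian_works:
  fixes \<phi> :: "real^'n \<Rightarrow> real"
  assumes "gradient \<phi> differentiable (at x)"
  shows "(gradient \<phi> has_derivative (\<lambda>v. hessian \<phi> x *v v)) (at x)"
  using assms jacobian_works unfolding hessian_def by blast

lemma hessian_unique:
  fixes \<phi> :: "real^'n \<Rightarrow> real"
  assumes "(gradient \<phi> has_derivative (\<lambda>v. A *v v)) (at x)"
  shows "hessian \<phi> x = A"
  by (simp add: hessian_def jacobian_def frechet_derivative_at[OF assms, symmetric])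

lemma hessian_sym:
  fixes \<phi> :: "real^'n \<Rightarrow> real"
  assumes "open S" "C2_on S \<phi>" "x \<in> S"
  shows "hessian \<phi> x \<in> sym_matrices"
proof -
  have "((\<lambda>y. gradient \<phi> y \<bullet> v) has_derivative (\<lambda>w. (hessian \<phi> x *v w) \<bullet> v)) (at x)" for v
    using assms by (intro has_derivative_inner_left hessian_works) (auto simp: C2_on_def)
  moreover have "(\<phi> has_derivative (\<lambda>v. gradient \<phi> y \<bullet> v)) (at y)" if "y \<in> S" for y
    using assms that by (intro gradient_works) (auto simp: C2_on_def)
  ultimately have "(hessian \<phi> x *v b) \<bullet> a = (hessian \<phi> x *v a) \<bullet> b" for a b
    using symmetric_second_derivative[OF assms(1,3),
        where D = "\<lambda>y v. gradient \<phi> y \<bullet> v" and H = "\<lambda>v w. (hessian \<phi> x *v w) \<bullet> v"]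
    by blast
  \<comment> \<open>On coordinate vectors the symmetric bilinear form reads off matrix
    entries.\<close>
  from this[of "axis j 1" "axis i 1" for i j] show ?thesis
    by (simp add: sym_matrices_def vec_eq_iff transpose_def matrix_vector_mult_basis column_def inner_axis)
qed

text \<open>\<psi> will be the test function: subtracting the quadratic shifts the Hessian by a
  multiple of the identity, small with \<open>e\<close>, and \<open>t\<close> only scales.\<close>

lemma
  fixes \<phi> :: "real^'n \<Rightarrow> real" and z :: "real^'n" and t e :: real
  assumes S: "open S" and \<phi>: "C2_on S \<phi>"
  defines "\<psi> \<equiv> \<lambda>x. t * (\<phi> x - e * ((x - z) \<bullet> (x - z)))"
  shows C2_on_perturb: "C2_on S \<psi>"
    and hessian_perturb: "\<And>x. x \<in> S \<Longrightarrow> hessian \<psi> x = t *\<^sub>R (hessian \<phi> x - (2 * e) *\<^sub>R mat 1)"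
proof -
  let ?g = "\<lambda>x. t *\<^sub>R (gradient \<phi> x - (2 * e) *\<^sub>R (x - z))"
  let ?H = "\<lambda>x. t *\<^sub>R (hessian \<phi> x - (2 * e) *\<^sub>R mat 1)"
  have d1: "(\<psi> has_derivative (\<lambda>v. ?g x \<bullet> v)) (at x)" if "x \<in> S" for x
  proof -
    have "(\<phi> has_derivative (\<lambda>v. gradient \<phi> x \<bullet> v)) (at x)"
      using that \<phi> by (intro gradient_works) (auto simp: C2_on_def)
    then show ?thesis unfolding \<psi>_def
      by (auto intro!: derivative_eq_intros simp: algebra_simps inner_commute)
  qed
  have "(?g has_derivative (\<lambda>v. ?H x *v v)) (at x)" if "x \<in> S" for x
  proof -
    have "(gradient \<phi> has_derivative (\<lambda>v. hessian \<phi> x *v v)) (at x)"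
      using that \<phi> by (intro hessian_works) (auto simp: C2_on_def)
    then show ?thesis
      by (auto intro!: derivative_eq_intros
          simp: scaleR_matrix_vector_assoc[symmetric] matrix_vector_mult_diff_rdistrib)
  qed
  \<comment> \<open>The formula for the gradient of \<psi> is known on \<open>S\<close> only;
    openness of \<open>S\<close> lets its derivative be transferred.\<close>
  then have d2: "(gradient \<psi> has_derivative (\<lambda>v. ?H x *v v)) (at x)" if "x \<in> S" for x
    using has_derivative_transform_within_open[OF _ S that, of ?g _ UNIV "gradient \<psi>"] that
      gradient_unique[OF d1] by auto
  show H: "hessian \<psi> x = ?H x" if "x \<in> S" for x
    using hessian_unique[OF d2[OF that]] .
  have "continuous_on S ?H"
    using \<phi> by (auto simp: C2_on_def intro!: continuous_intros)
  then have "continuous_on S (hessian \<psi>)"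
    using H by (simp cong: continuous_on_cong)
  then show "C2_on S \<psi>"
    using d1 d2 unfolding C2_on_def by (blast intro: differentiableI)
qed

section \<open>Lower semicontinuous functions\<close>

lemma LSC_on_subset: "LSC_on S u \<Longrightarrow> T \<subseteq> S \<Longrightarrow> LSC_on T u"
  unfolding LSC_on_def by (meson at_le filter_leD subsetD)

lemma LSC_on_diff:
  assumes "LSC_on S u" and "continuous_on S v"
  shows "LSC_on S (\<lambda>x. u x - v x)"
  unfolding LSC_on_def
proof (intro ballI allI impI)
  fix x a assume x: "x \<in> S" and a: "a < u x - v x"
  \<comment> \<open>Half of the gap: \<open>u\<close> may drop and \<open>v\<close> may rise by this
    amount.\<close>
  define d where "d = (u x - v x - a) / 2"
  have d: "d > 0" using a by (simp add: d_def)
  have "\<forall>\<^sub>F y in at x within S. u x - d < u y"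
    using assms(1) x d unfolding LSC_on_def by simp
  moreover have "\<forall>\<^sub>F y in at x within S. v y < v x + d"
    using assms(2) x d unfolding continuous_on by (auto intro: order_tendstoD)
  ultimately show "\<forall>\<^sub>F y in at x within S. a < u y - v y"
    by eventually_elim (simp add: d_def field_simps)
qed

lemma LSC_on_openin_superlevel:
  assumes "LSC_on S u"
  shows "openin (top_of_set S) {x \<in> S. a < u x}"
proof (subst openin_subopen, intro ballI)
  fix x assume x: "x \<in> {x \<in> S. a < u x}"
  then have "\<forall>\<^sub>F y in at x within S. a < u y"
    using assms unfolding LSC_on_def by simp
  then obtain T where T: "open T" "x \<in> T" "\<And>y. y \<in> T \<Longrightarrow> y \<noteq> x \<Longrightarrow> y \<in> S \<Longrightarrow> a < u y"
    unfolding eventually_at_topological by blast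
  then have "openin (top_of_set S) (S \<inter> T)" by (simp add: openin_open_Int)
  \<comment> \<open>\<open>T\<close> controls only points other than \<open>x\<close>; at
    \<open>x\<close> the inequality is the assumption.\<close>
  moreover have "x \<in> S \<inter> T" "S \<inter> T \<subseteq> {x \<in> S. a < u x}" using T x by auto
  ultimately show "\<exists>T. openin (top_of_set S) T \<and> x \<in> T \<and> T \<subseteq> {x \<in> S. a < u x}" by blast
qed

text \<open>Without a minimum, the relatively open sets where \<open>u\<close> exceeds
  \<open>u y\<close> cover \<open>K\<close>. Among the finitely many centres of a subcover, one with
  least value would have to exceed the value at another centre.\<close>

lemma LSC_on_attains_inf:
  assumes K: "compact K" "K \<noteq> {}" and u: "LSC_on K u"
  obtains x where "x \<in> K" "\<And>y. y \<in> K \<Longrightarrow> u x \<le> u y"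
proof (rule ccontr)
  assume "\<not> thesis"
  then have low: "\<exists>y\<in>K. u y < u x" if "x \<in> K" for x
    using that \<open>\<And>x. \<lbrakk>x \<in> K; \<And>y. y \<in> K \<Longrightarrow> u x \<le> u y\<rbrakk> \<Longrightarrow> thesis\<close> by (meson not_le)
  have "\<exists>T. open T \<and> {x \<in> K. u y < u x} = K \<inter> T" for y
    using LSC_on_openin_superlevel[OF u] by (simp add: openin_open)
  then obtain T where T: "\<And>y. open (T y)" "\<And>y. {x \<in> K. u y < u x} = K \<inter> T y"
    by metis
  have "K \<subseteq> (\<Union>y\<in>K. T y)" using low T(2) by blast
  then obtain C where C: "C \<subseteq> K" "finite C" "K \<subseteq> (\<Union>y\<in>C. T y)"
    using compactE_image[OF K(1), of K T] T(1) by blast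
  have "C \<noteq> {}" using C K by auto
  then obtain m where m: "m \<in> C" "\<And>y. y \<in> C \<Longrightarrow> u m \<le> u y"
    using arg_min_if_finite[OF C(2), of u] by (meson not_le)
  then obtain y where "y \<in> C" "m \<in> T y" using C by blast
  then have "u y < u m" using T(2)[of y] m(1) C(1) by blast
  then show False using m(2)[OF \<open>y \<in> C\<close>] by simp
qed

section \<open>Strict positivity of nonnegative supersolutions\<close>

theorem theorem13:
  fixes \<Omega> \<Gamma> :: "(real^'n) set"
    and f u :: "real^'n \<Rightarrow> real"
    and F :: "real^'n^'n \<Rightarrow> real"
  assumes "open \<Omega>"
    and "continuous_on \<Omega> f"
    and "\<forall>x\<in>\<Omega>. f x \<le> 0"
    and "\<Gamma> = {x \<in> \<Omega>. f x = 0}"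
    and "condF1 F" and "condF2 F" and "condF4 F"
    and "F 0 \<ge> 0"
    and "\<Gamma> \<noteq> \<Omega>"
    and "supersolution F f \<Omega> u"
    and "\<forall>x\<in>\<Omega>. u x \<ge> 0"
    and "\<forall>\<Gamma>\<^sub>0. \<Gamma>\<^sub>0 \<noteq> {} \<and> closedin (top_of_set \<Gamma>) \<Gamma>\<^sub>0 \<longrightarrow> \<not> condG F \<Omega> (\<Omega> - \<Gamma>\<^sub>0)"
  shows "\<forall>x\<in>\<Omega>. u x > 0"
proof (rule ccontr)
  assume not_pos: "\<not> (\<forall>x\<in>\<Omega>. u x > 0)"
  define \<Gamma>\<^sub>0 where "\<Gamma>\<^sub>0 = {x \<in> \<Omega>. u x = 0}"
  note u0 = assms(11)
  have ne: "\<Gamma>\<^sub>0 \<noteq> {}" using not_pos u0 by (force simp: \<Gamma>\<^sub>0_def)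
  have lsc: "LSC_on \<Omega> u" using assms(10) by (simp add: supersolution_def)
  have test: "F (hessian \<phi> w) \<le> f w"
    if "C2_on \<Omega> \<phi>" "w \<in> \<Omega>" "\<forall>\<^sub>F y in at w within \<Omega>. u w - \<phi> w \<le> u y - \<phi> y" for \<phi> w
    using assms(10) that unfolding supersolution_def by blast

  have grad0: "gradient (\<lambda>_. 0) = (\<lambda>_::real^'n. 0)"
    by (auto intro!: gradient_unique)
  then have hess0: "hessian (\<lambda>_. 0) = (\<lambda>_::real^'n. 0)"
    by (auto intro!: hessian_unique)
  have C20: "C2_on \<Omega> (\<lambda>_. 0)" by (simp add: C2_on_def grad0 hess0)
  have sub: "\<Gamma>\<^sub>0 \<subseteq> \<Gamma>"
  proof
    fix x assume "x \<in> \<Gamma>\<^sub>0"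
    then have x: "x \<in> \<Omega>" "u x = 0" by (auto simp: \<Gamma>\<^sub>0_def)
    \<comment> \<open>Since \<open>u\<close> has its minimum 0 at \<open>x\<close>, this says
      \<open>F 0 \<le> f x\<close>; with \<open>F 0 \<ge> 0\<close> and \<open>f x \<le> 0\<close>
      it forces \<open>f x = 0\<close>.\<close>
    have "F (hessian (\<lambda>_. 0) x) \<le> f x"
      using x u0 by (intro test C20) (auto simp: eventually_at_filter)
    then show "x \<in> \<Gamma>" using assms(3,4,8) x by (force simp: hess0)
  qed
  have "\<Gamma>\<^sub>0 = \<Omega> - {x \<in> \<Omega>. 0 < u x}" using u0 by (force simp: \<Gamma>\<^sub>0_def)
  then have "closedin (top_of_set \<Omega>) \<Gamma>\<^sub>0"
    using LSC_on_openin_superlevel[OF lsc, of 0] by auto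
  then have "closedin (top_of_set \<Gamma>) \<Gamma>\<^sub>0"
    using sub assms(4) by (auto elim!: closedin_subset_trans)
  then have "\<not> condG F \<Omega> (\<Omega> - \<Gamma>\<^sub>0)" using ne assms(12) by blast
  moreover have "\<Omega> - (\<Omega> - \<Gamma>\<^sub>0) = \<Gamma>\<^sub>0" by (auto simp: \<Gamma>\<^sub>0_def)
  ultimately obtain \<phi> z where \<phi>: "C2_on \<Omega> \<phi>" and z: "z \<in> \<Gamma>\<^sub>0" "\<phi> z = 0"
    and max: "\<And>x. x \<in> \<Gamma>\<^sub>0 \<Longrightarrow> \<phi> x \<le> 0" and Fz: "F (hessian \<phi> z) > 0"
    unfolding condG_def by (auto simp: not_le)
  have z\<Omega>: "z \<in> \<Omega>" "u z = 0" using z by (auto simp: \<Gamma>\<^sub>0_def)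
  have sym: "hessian \<phi> x \<in> sym_matrices" if "x \<in> \<Omega>" for x
    using hessian_sym[OF assms(1) \<phi> that] .

  obtain d where d: "d > 0"
    and Fd: "\<And>Y. Y \<in> sym_matrices \<Longrightarrow> dist Y (hessian \<phi> z) < d \<Longrightarrow> F Y > 0"
  proof -
    obtain d where "d > 0" "\<forall>Y\<in>sym_matrices. dist Y (hessian \<phi> z) < d \<longrightarrow>
        dist (F Y) (F (hessian \<phi> z)) < F (hessian \<phi> z)"
      using assms(5) sym[OF z\<Omega>(1)] Fz unfolding condF1_def continuous_on_iff by blast
    then show ?thesis by (intro that[of d]) (force simp: dist_real_def)+
  qed
  define n where "n = norm (mat 1 :: real^'n^'n)"
  \<comment> \<open>The tolerance \<open>d\<close> is split: the penalty shifts the Hessian by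
    \<open>2 * e * n < d / 2\<close>, and the other half is left for the variation of the Hessian of
    \<phi> near \<open>z\<close>.\<close>
  define e where "e = d / (4 * (n + 1))"
  have n: "n \<ge> 0" by (simp add: n_def)
  have e: "e > 0" using d n by (simp add: e_def)
  have "norm ((2 * e) *\<^sub>R (mat 1 :: real^'n^'n)) = 2 * e * n"
    using e by (simp add: n_def)
  also have "\<dots> < d / 2" using d n by (simp add: e_def field_simps)
  finally have e_norm: "norm ((2 * e) *\<^sub>R (mat 1 :: real^'n^'n)) < d / 2" .
  obtain r1 where r1: "r1 > 0" "\<And>x. x \<in> \<Omega> \<Longrightarrow> dist x z < r1 \<Longrightarrow> dist (hessian \<phi> x) (hessian \<phi> z) < d / 2"
    using \<phi> z\<Omega>(1) half_gt_zero[OF d] unfolding C2_on_def continuous_on_iff by blast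
  obtain r2 where r2: "r2 > 0" "ball z r2 \<subseteq> \<Omega>"
    using assms(1) z\<Omega>(1) openE by blast
  define r where "r = min r1 r2 / 2"
  have r: "r > 0" "r < r1" "r < r2" using r1 r2 by (auto simp: r_def)
  have cb: "cball z r \<subseteq> \<Omega>" using r r2 by (force simp: subset_iff)

  define \<psi> where "\<psi> x = \<phi> x - e * ((x - z) \<bullet> (x - z))" for x
  have \<phi>cont: "continuous_on \<Omega> \<phi>"
    using \<phi> by (intro differentiable_imp_continuous_on)
      (auto simp: C2_on_def differentiable_on_def intro: differentiable_at_withinI)
  have \<psi>cont: "continuous_on (cball z r) \<psi>"
    unfolding \<psi>_def by (intro continuous_intros continuous_on_subset[OF \<phi>cont cb])
  have Hpos: "F (hessian \<phi> x - (2 * e) *\<^sub>R mat 1) > 0"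
    and Hsym: "hessian \<phi> x - (2 * e) *\<^sub>R mat 1 \<in> sym_matrices" if x: "x \<in> cball z r" for x
  proof -
    have x\<Omega>: "x \<in> \<Omega>" using cb x by blast
    show Hs: "hessian \<phi> x - (2 * e) *\<^sub>R mat 1 \<in> sym_matrices"
      using sym[OF x\<Omega>] by (auto simp: sym_matrices_def transpose_def mat_def vec_eq_iff)
    have "dist (hessian \<phi> x) (hessian \<phi> z) < d / 2"
      using x r x\<Omega> by (intro r1(2)) (auto simp: dist_commute)
    then have "norm ((hessian \<phi> x - hessian \<phi> z) - (2 * e) *\<^sub>R mat 1) < d"
      using e_norm norm_triangle_ineq4[of "hessian \<phi> x - hessian \<phi> z" "(2 * e) *\<^sub>R (mat 1 :: real^'n^'n)"]
      unfolding dist_norm by linarith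
    then show "F (hessian \<phi> x - (2 * e) *\<^sub>R mat 1) > 0"
      by (intro Fd Hs) (simp add: dist_norm algebra_simps)
  qed

  \<comment> \<open>Only on this part of the sphere can subtracting a positive multiple of \<psi>
    destroy positivity; elsewhere on it \<psi> is negative and \<open>u \<ge> 0\<close>
    suffices.\<close>
  define S where "S = {x \<in> sphere z r. \<psi> x \<ge> 0}"
  have S_cb: "S \<subseteq> cball z r" by (auto simp: S_def)
  have "continuous_on (sphere z r) \<psi>" by (rule continuous_on_subset[OF \<psi>cont]) auto
  then have "closed S" unfolding S_def
    by (intro continuous_on_closed_Collect_le) auto
  then have Sc: "compact S"
    using S_cb by (meson bounded_cball bounded_subset compact_eq_bounded_closed)
  \<comment> \<open>On \<open>S\<close>, \<phi> is at least the positive penalty, so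
    \<open>S\<close> misses the zero set of \<open>u\<close>.\<close>
  have upos: "u x > 0" if "x \<in> S" for x
  proof (rule ccontr)
    have x: "x \<in> \<Omega>" "x \<noteq> z" "\<psi> x \<ge> 0" using that S_cb cb r by (auto simp: S_def)
    assume "\<not> u x > 0"
    then have "\<phi> x \<le> 0" using x u0 by (intro max) (force simp: \<Gamma>\<^sub>0_def)
    moreover have "e * ((x - z) \<bullet> (x - z)) > 0" using e x(2) by simp
    ultimately show False using x(3) by (simp add: \<psi>_def)
  qed
  obtain m where m: "m > 0" "\<And>x. x \<in> S \<Longrightarrow> m \<le> u x"
  proof (cases "S = {}")
    case False
    have "LSC_on S u" using LSC_on_subset[OF lsc] S_cb cb by blast
    then obtain x where "x \<in> S" "\<And>y. y \<in> S \<Longrightarrow> u x \<le> u y"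
      using LSC_on_attains_inf[OF Sc False] by blast
    then show ?thesis using that upos by blast
  \<comment> \<open>For empty \<open>S\<close> the bound is vacuous and any positive
    \<open>m\<close> serves.\<close>
  qed (use that[of 1] in auto)
  obtain B where B: "B > 0" "\<And>x. x \<in> cball z r \<Longrightarrow> \<psi> x < B"
  proof -
    have "bounded (\<psi> ` cball z r)"
      by (intro compact_imp_bounded compact_continuous_image \<psi>cont compact_cball)
    then obtain B where "B > 0" "\<forall>x\<in>cball z r. \<bar>\<psi> x\<bar> < B"
      unfolding bounded_pos_less by auto
    then show ?thesis by (intro that[of B]) (auto simp: abs_less_iff)
  qed
  \<comment> \<open>With this \<open>t\<close>, \<open>t * \<psi> x < m \<le> u x\<close> on
    \<open>S\<close>.\<close>
  define t where "t = m / B"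
  have t: "t > 0" using m B by (simp add: t_def)

  define g where "g x = u x - t * \<psi> x" for x
  have gz: "g z = 0" by (simp add: g_def \<psi>_def z z\<Omega>)
  have g_sphere: "g x > 0" if x: "x \<in> sphere z r" for x
  proof (cases "x \<in> S")
    case True
    have "t * \<psi> x < t * B" using B(2)[of x] t x by simp
    also have "t * B = m" using B by (simp add: t_def)
    finally show ?thesis using m(2)[OF True] by (simp add: g_def)
  next
    case False
    then have "t * \<psi> x < 0" using x t by (simp add: S_def mult_pos_neg)
    moreover have "u x \<ge> 0" using x cb u0 by auto
    ultimately show ?thesis by (simp add: g_def)
  qed
  have "LSC_on (cball z r) g" unfolding g_def
    by (intro LSC_on_diff LSC_on_subset[OF lsc cb] continuous_intros \<psi>cont)
  moreover have "cball z r \<noteq> {}" using r by simp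
  ultimately obtain w where w: "w \<in> cball z r" "\<And>y. y \<in> cball z r \<Longrightarrow> g w \<le> g y"
    using LSC_on_attains_inf[OF compact_cball] by blast
  \<comment> \<open>Comparison with the centre keeps the minimizer off the sphere, where
    \<open>g\<close> is positive; hence it is an interior local minimum.\<close>
  have "g w \<le> 0" using w(2)[of z] gz r by simp
  then have wb: "w \<in> ball z r" using w(1) g_sphere[of w] by (force simp: less_le)
  have w\<Omega>: "w \<in> \<Omega>" using w cb by blast
  have min: "\<forall>\<^sub>F y in at w within \<Omega>. u w - t * \<psi> w \<le> u y - t * \<psi> y"
    unfolding eventually_at_topological
    using wb w(2) by (intro exI[of _ "ball z r"]) (auto simp: g_def)
  have "C2_on \<Omega> (\<lambda>x. t * \<psi> x)" unfolding \<psi>_def by (rule C2_on_perturb[OF assms(1) \<phi>])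
  from test[OF this w\<Omega> min]
  have "F (hessian (\<lambda>x. t * \<psi> x) w) \<le> 0" using assms(3) w\<Omega> by force
  then have F_le: "F (t *\<^sub>R (hessian \<phi> w - (2 * e) *\<^sub>R mat 1)) \<le> 0"
    unfolding \<psi>_def hessian_perturb[OF assms(1) \<phi> w\<Omega>] .
  \<comment> \<open>The factor \<open>h t\<close> is positive, so \<open>F\<close> has the same sign
    before and after scaling by \<open>t\<close>, against \<open>F_le\<close>.\<close>
  obtain h where "h t > 0" "F (t *\<^sub>R (hessian \<phi> w - (2 * e) *\<^sub>R mat 1))
      = h t * F (hessian \<phi> w - (2 * e) *\<^sub>R mat 1)"
    using assms(7) t Hsym[OF w(1)] unfolding condF4_def by blast
  then have "F (t *\<^sub>R (hessian \<phi> w - (2 * e) *\<^sub>R mat 1)) > 0"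
    using Hpos[OF w(1)] by simp
  then show False using F_le by simp
qed

end
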